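(* Let $(\mathfrak g,[\cdot,\cdot,\cdot]_{\mathfrak g})$ be a 3-Lie algebra and $(V;\rho)$ a representation of $\mathfrak g$. Let $\Omega$ denote the semi-direct product 3-Lie bracket on $\mathfrak g\oplus V$. Then a linear map $T:V\to\mathfrak g$ is an $\mathcal O$-operator on $(\mathfrak g,[\cdot,\cdot,\cdot]_{\mathfrak g})$ with respect to $(V;\rho)$ if and only if $((\mathfrak g\oplus V,\Omega^T),\mathfrak g,V)$ is a twilled 3-Lie algebra.
   Context: All vector spaces are finite-dimensional over an algebraically closed field of characteristic $0$. **3-Lie algebra.** A vector space with a skew-symmetric trilinear bracket satisfying $[x_1,x_2,[x_3,x_4,x_5]]=[[x_1,x_2,x_3],x_4,x_5]+[x_3,[x_1,x_2,x_4],x_5]+[x_3,x_4,[x_1,x_2,x_5]]$. **Representation.** A linear map $\rho:\wedge^2\mathfrak g\to\mathfrak{gl}(V)$ with $\rho(x_1,x_2)\rho(x_3,x_4)=\rho([x_1,x_2,x_3]_{\mathfrak g},x_4)+\rho(x_3,[x_1,x_2,x_4]_{\mathfrak g})+\rho(x_3,x_4)\rho(x_1,x_2)$ and $\rho(x_1,[x_2,x_3,x_4]_{\mathfrak g})=\rho(x_3,x_4)\rho(x_1,x_2)-\rho(x_2,x_4)\rho(x_1,x_3)+\rho(x_2,x_3)\rho(x_1,x_4)$. **Semi-direct product.** $\Omega(x+u,y+v,z+w)=[x,y,z]_{\mathfrak g}+\rho(x,y)w+\rho(y,z)u+\rho(z,x)v$ for $x,y,z\in\mathfrak g$, $u,v,w\in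 V$. **$\mathcal O$-operator.** A linear map $T:V\to\mathfrak g$ with $[Tu,Tv,Tw]_{\mathfrak g}=T(\rho(Tu,Tv)w+\rho(Tv,Tw)u+\rho(Tw,Tu)v)$ for all $u,v,w\in V$. **Twilled 3-Lie algebra.** A triple $(\mathcal G,\mathfrak g_1,\mathfrak g_2)$ where $\mathcal G$ is a 3-Lie algebra, $\mathcal G=\mathfrak g_1\oplus\mathfrak g_2$ as vector spaces, and $\mathfrak g_1,\mathfrak g_2$ are subalgebras. **Twisting.** Let $\hat T(x+u)=T(u)$ on $\mathcal G=\mathfrak g\oplus V$. For $\Theta\in\mathrm{Hom}(\wedge^3\mathcal G,\mathcal G)$ put $[\Theta,\hat T](a,b,c)=\Theta(\hat Ta,b,c)+\Theta(a,\hat Tb,c)+\Theta(a,b,\hat Tc)-\hat T\Theta(a,b,c)$. Then $\Omega^T:=e^{[\cdot,\hat T]}\Omega=\sum_{i\ge0}\frac1{i!}([\cdot,\hat T])^i\Omega$ (a finite sum). *)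

theory Defs
  imports "HOL-Analysis.Product_Vector" "HOL-Computational_Algebra.Polynomial"
    "HOL-Library.Groups_Big_Fun"
begin

locale fin_dim_space = vector_space s
  for s :: "'k::{alg_closed_field,field_char_0} \<Rightarrow> 'a::ab_group_add \<Rightarrow> 'a" +
  assumes finite_dim: "\<exists>B. finite_dimensional_vector_space s B"

definition trilinear ::
  "('k::field \<Rightarrow> 'a::ab_group_add \<Rightarrow> 'a) \<Rightarrow> ('a \<Rightarrow> 'a \<Rightarrow> 'a \<Rightarrow> 'a) \<Rightarrow> bool" where
  "trilinear s f \<longleftrightarrow>
     (\<forall>y z. Vector_Spaces.linear s s (\<lambda>x. f x y z)) \<and>
     (\<forall>x z. Vector_Spaces.linear s s (\<lambda>y. f x y z)) \<and>
     (\<forall>x y. Vector_Spaces.linear s s (\<lambda>z. f x y z))"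

text \<open>Skew-symmetry is imposed on the two adjacent transpositions, which generate \<open>S\<^sub>3\<close>.\<close>

locale three_Lie_algebra = fin_dim_space s
  for s :: "'k::{alg_closed_field,field_char_0} \<Rightarrow> 'a::ab_group_add \<Rightarrow> 'a" +
  fixes br :: "'a \<Rightarrow> 'a \<Rightarrow> 'a \<Rightarrow> 'a"
  assumes trilinear: "trilinear s br"
    and skew12: "br y x z = - br x y z"
    and skew23: "br x z y = - br x y z"
    and fundamental_identity:
      "br x1 x2 (br x3 x4 x5) =
         br (br x1 x2 x3) x4 x5 + br x3 (br x1 x2 x4) x5 + br x3 x4 (br x1 x2 x5)"

text \<open>\<open>\<rho> x y\<close> is the endomorphism of \<open>V\<close> assigned to \<open>x \<and> y\<close>: a linear map on the exterior
  square of \<open>g\<close> is given as a skew-symmetric bilinear map.\<close>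

locale three_Lie_representation =
  g: three_Lie_algebra sg br + V: fin_dim_space sv
  for sg :: "'k::{alg_closed_field,field_char_0} \<Rightarrow> 'g::ab_group_add \<Rightarrow> 'g"
    and br :: "'g \<Rightarrow> 'g \<Rightarrow> 'g \<Rightarrow> 'g"
    and sv :: "'k \<Rightarrow> 'v::ab_group_add \<Rightarrow> 'v" +
  fixes \<rho> :: "'g \<Rightarrow> 'g \<Rightarrow> 'v \<Rightarrow> 'v"
  assumes endo: "Vector_Spaces.linear sv sv (\<rho> x y)"
    and linear1: "Vector_Spaces.linear sg sv (\<lambda>x. \<rho> x y v)"
    and linear2: "Vector_Spaces.linear sg sv (\<lambda>y. \<rho> x y v)"
    and skew: "\<rho> y x v = - \<rho> x y v"
    and rep1: "\<rho> x1 x2 (\<rho> x3 x4 v) =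
      \<rho> (br x1 x2 x3) x4 v + \<rho> x3 (br x1 x2 x4) v + \<rho> x3 x4 (\<rho> x1 x2 v)"
    and rep2: "\<rho> x1 (br x2 x3 x4) v =
      \<rho> x3 x4 (\<rho> x1 x2 v) - \<rho> x2 x4 (\<rho> x1 x3 v) + \<rho> x2 x3 (\<rho> x1 x4 v)"

definition semidirect ::
  "('g \<Rightarrow> 'g \<Rightarrow> 'g \<Rightarrow> 'g) \<Rightarrow> ('g \<Rightarrow> 'g \<Rightarrow> 'v \<Rightarrow> 'v::ab_group_add) \<Rightarrow>
   'g \<times> 'v \<Rightarrow> 'g \<times> 'v \<Rightarrow> 'g \<times> 'v \<Rightarrow> 'g \<times> 'v" where
  "semidirect br \<rho> = (\<lambda>(x, u) (y, v) (z, w). (br x y z, \<rho> x y w + \<rho> y z u + \<rho> z x v))"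

definition O_operator ::
  "('k::field \<Rightarrow> 'g::ab_group_add \<Rightarrow> 'g) \<Rightarrow> ('g \<Rightarrow> 'g \<Rightarrow> 'g \<Rightarrow> 'g) \<Rightarrow>
   ('k \<Rightarrow> 'v::ab_group_add \<Rightarrow> 'v) \<Rightarrow> ('g \<Rightarrow> 'g \<Rightarrow> 'v \<Rightarrow> 'v) \<Rightarrow> ('v \<Rightarrow> 'g) \<Rightarrow> bool" where
  "O_operator sg br sv \<rho> T \<longleftrightarrow>
     Vector_Spaces.linear sv sg T \<and>
     (\<forall>u v w. br (T u) (T v) (T w) =
        T (\<rho> (T u) (T v) w + \<rho> (T v) (T w) u + \<rho> (T w) (T u) v))"

definition subalgebra ::
  "('k::field \<Rightarrow> 'a::ab_group_add \<Rightarrow> 'a) \<Rightarrow> ('a \<Rightarrow> 'a \<Rightarrow> 'a \<Rightarrow> 'a) \<Rightarrow> 'a set \<Rightarrow> bool" where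
  "subalgebra s br S \<longleftrightarrow>
     module.subspace s S \<and> (\<forall>x\<in>S. \<forall>y\<in>S. \<forall>z\<in>S. br x y z \<in> S)"

definition twilled_three_Lie_algebra ::
  "('k::{alg_closed_field,field_char_0} \<Rightarrow> 'a::ab_group_add \<Rightarrow> 'a) \<Rightarrow>
   ('a \<Rightarrow> 'a \<Rightarrow> 'a \<Rightarrow> 'a) \<Rightarrow> 'a set \<Rightarrow> 'a set \<Rightarrow> bool" where
  "twilled_three_Lie_algebra s br G1 G2 \<longleftrightarrow>
     three_Lie_algebra s br \<and>
     subalgebra s br G1 \<and> subalgebra s br G2 \<and>
     G1 \<inter> G2 = {0} \<and> {x + y | x y. x \<in> G1 \<and> y \<in> G2} = UNIV"

definition lift_op :: "('v \<Rightarrow> 'g::zero) \<Rightarrow> 'g \<times> 'v \<Rightarrow> 'g \<times> 'v::zero" where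
  "lift_op T a = (T (snd a), 0)"

definition op_bracket ::
  "('a \<Rightarrow> 'a) \<Rightarrow> ('a \<Rightarrow> 'a \<Rightarrow> 'a \<Rightarrow> 'a) \<Rightarrow> 'a \<Rightarrow> 'a \<Rightarrow> 'a \<Rightarrow> 'a::ab_group_add" where
  "op_bracket S \<Theta> a b c = \<Theta> (S a) b c + \<Theta> a (S b) c + \<Theta> a b (S c) - S (\<Theta> a b c)"

text \<open>The exponential series of \<open>[\<cdot>, S]\<close>. \<open>Sum_any\<close> sums over the indices of nonzero terms; there
  are finitely many of them when \<open>S \<circ> S = 0\<close>, as for \<open>S = lift_op T\<close> (see
  \<open>op_bracket_iterate_eq_0\<close> below), so its default value for infinite support plays no role.\<close>

definition exp_twist ::
  "('k::field_char_0 \<Rightarrow> 'a::ab_group_add \<Rightarrow> 'a) \<Rightarrow> ('a \<Rightarrow> 'a) \<Rightarrow>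
   ('a \<Rightarrow> 'a \<Rightarrow> 'a \<Rightarrow> 'a) \<Rightarrow> 'a \<Rightarrow> 'a \<Rightarrow> 'a \<Rightarrow> 'a" where
  "exp_twist s S \<Theta> a b c =
     Sum_any (\<lambda>i. s (1 / fact i) ((op_bracket S ^^ i) \<Theta> a b c))"

lemma op_bracket_iterate_eq_0:
  fixes \<Theta> :: "'a::ab_group_add \<Rightarrow> 'a \<Rightarrow> 'a \<Rightarrow> 'a"
  assumes "trilinear s \<Theta>" and "Vector_Spaces.linear s s S"
    and SS: "\<And>x. S (S x) = 0" and "i \<ge> 5"
  shows "(op_bracket S ^^ i) \<Theta> = (\<lambda>_ _ _. 0)"
proof -
  interpret S: Vector_Spaces.linear s s S by fact
  have [simp]: "\<Theta> 0 b c = 0" "\<Theta> a 0 c = 0" "\<Theta> a b 0 = 0" for a b c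
    using assms(1) unfolding trilinear_def
    by (metis module_hom.zero Vector_Spaces.linear.axioms(3))+
  have 5: "(op_bracket S ^^ 5) \<Theta> = (\<lambda>_ _ _. 0)"
    by (intro ext) (simp add: numeral_eq_Suc op_bracket_def SS S.add S.diff S.neg S.zero)
  have "(op_bracket S ^^ (n + 5)) \<Theta> = (\<lambda>_ _ _. 0)" for n
  proof (induction n)
    case 0
    then show ?case using 5 by simp
  next
    case (Suc n)
    have "(op_bracket S ^^ (Suc n + 5)) \<Theta> = op_bracket S (\<lambda>_ _ _. 0)"
      by (simp only: add_Suc funpow.simps o_apply Suc.IH)
    also have "\<dots> = (\<lambda>_ _ _. 0)"
      by (intro ext) (simp add: op_bracket_def S.zero)
    finally show ?case .
  qed
  from this[of "i - 5"] \<open>i \<ge> 5\<close> show ?thesis by simp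
qed

end

theory Submission
  imports Defs
begin

text \<open>
  The point is that twisting is conjugation. Since \<open>S = lift_op T\<close> squares to zero, \<open>1 + S\<close> is
  an automorphism of the vector space with inverse \<open>1 - S\<close>, and summing the exponential series
  gives \<open>\<Omega>\<^sup>T(a, b, c) = (1 - S) \<Omega>((1 + S) a, (1 + S) b, (1 + S) c)\<close>
  (\<open>exp_twist_eq_conjugate\<close>). So the twist of a 3-Lie bracket is the same bracket transported
  along an isomorphism, and is a 3-Lie bracket for every linear \<open>T\<close>
  (\<open>three_Lie_algebra_transport\<close>, applied to \<open>semidirect_three_Lie_algebra\<close>). Moreover
  \<open>S\<close> vanishes on \<open>g\<close>, so the twisted bracket restricts to the original one there and \<open>g\<close>
  is always a subalgebra.

  All the content therefore lies in \<open>V\<close> being a subalgebra. On \<open>V\<close> the map \<open>1 + S\<close> is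
  \<open>u \<mapsto> T u + u\<close>, the parametrisation of the graph of \<open>T\<close>, and the \<open>g\<close>-component of the
  twisted bracket of \<open>u, v, w\<close> is
  \<open>[Tu, Tv, Tw] - T(\<rho>(Tu, Tv) w + \<rho>(Tv, Tw) u + \<rho>(Tw, Tu) v)\<close>, whose vanishing is the defining equation of an \<open>\<O>\<close>-operator.
\<close>

section \<open>The exponential twist as a conjugation\<close>

lemma trilinearD:
  assumes "trilinear s f"
  shows "f (x + x') y z = f x y z + f x' y z"
    and "f x (y + y') z = f x y z + f x y' z"
    and "f x y (z + z') = f x y z + f x y z'"
    and "f (s k x) y z = s k (f x y z)"
    and "f x (s k y) z = s k (f x y z)"
    and "f x y (s k z) = s k (f x y z)"
    and "f 0 y z = 0" and "f x 0 z = 0" and "f x y 0 = 0"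
proof -
  interpret L1: Vector_Spaces.linear s s "\<lambda>x. f x y z" for y z
    using assms unfolding trilinear_def by blast
  interpret L2: Vector_Spaces.linear s s "\<lambda>y. f x y z" for x z
    using assms unfolding trilinear_def by blast
  interpret L3: Vector_Spaces.linear s s "\<lambda>z. f x y z" for x y
    using assms unfolding trilinear_def by blast
  show "f (x + x') y z = f x y z + f x' y z" by (rule L1.add)
  show "f x (y + y') z = f x y z + f x y' z" by (rule L2.add)
  show "f x y (z + z') = f x y z + f x y z'" by (rule L3.add)
  show "f (s k x) y z = s k (f x y z)" by (rule L1.scale)
  show "f x (s k y) z = s k (f x y z)" by (rule L2.scale)
  show "f x y (s k z) = s k (f x y z)" by (rule L3.scale)
  show "f 0 y z = 0" by (rule L1.zero)
  show "f x 0 z = 0" by (rule L2.zero)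
  show "f x y 0 = 0" by (rule L3.zero)
qed

text \<open>Expand \<open>(1 - S) \<Theta> (1 + S)\<^sup>\<otimes>\<^sup>3\<close> into the parts \<open>F i\<close> that contain \<open>S\<close> exactly \<open>i\<close> times.
  Bracketing with \<open>S\<close> inserts one more \<open>S\<close> at each of the three inputs and, with a
  minus sign, at the output; it contributes nothing where an \<open>S\<close> already stands, as \<open>S\<close> squares
  to zero. So every term of \<open>F (i + 1)\<close>
  arises in this way from \<open>i + 1\<close> terms of \<open>F i\<close>. Hence the \<open>i\<close>-th iterate is \<open>i! F i\<close>, and the
  factorials of the exponential series cancel.\<close>

lemma exp_twist_eq_conjugate:
  fixes s :: "'k::field_char_0 \<Rightarrow> 'a::ab_group_add \<Rightarrow> 'a"
  assumes tri: "trilinear s \<Theta>" and lin: "Vector_Spaces.linear s s S"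
    and SS: "\<And>x. S (S x) = 0"
  shows "exp_twist s S \<Theta> = (\<lambda>a b c. (\<lambda>x. x - S x) (\<Theta> (a + S a) (b + S b) (c + S c)))"
proof (intro ext)
  fix a b c
  interpret S: Vector_Spaces.linear s s S by fact
  note S_simps = S.add S.diff S.neg S.zero SS
  define F1 where "F1 = (\<lambda>a b c. \<Theta> (S a) b c + \<Theta> a (S b) c + \<Theta> a b (S c) - S (\<Theta> a b c))"
  define F2 where "F2 = (\<lambda>a b c. \<Theta> (S a) (S b) c + \<Theta> (S a) b (S c) + \<Theta> a (S b) (S c)
    - S (\<Theta> (S a) b c + \<Theta> a (S b) c + \<Theta> a b (S c)))"
  define F3 where "F3 = (\<lambda>a b c. \<Theta> (S a) (S b) (S c)
    - S (\<Theta> (S a) (S b) c + \<Theta> (S a) b (S c) + \<Theta> a (S b) (S c)))"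
  define F4 where "F4 = (\<lambda>a b c. - S (\<Theta> (S a) (S b) (S c)))"
  have scale: "op_bracket S (\<lambda>a b c. s k (F a b c)) = (\<lambda>a b c. s k (op_bracket S F a b c))"
    for k and F :: "'a \<Rightarrow> 'a \<Rightarrow> 'a \<Rightarrow> 'a"
    by (intro ext)
      (simp add: op_bracket_def S.scale S.vs1.scale_right_distrib S.vs1.scale_right_diff_distrib)
  have small: "s 2 x = x + x" "s 3 x = x + x + x" "s 4 x = x + x + x + x" for x
    using S.vs1.scale_left_distrib[of 1 1 x] S.vs1.scale_left_distrib[of 2 1 x]
      S.vs1.scale_left_distrib[of 3 1 x] by simp_all
  have D1: "op_bracket S \<Theta> = F1"
    by (intro ext) (simp add: op_bracket_def F1_def)
  have D2: "op_bracket S F1 = (\<lambda>a b c. s 2 (F2 a b c))"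
    by (intro ext) (simp add: op_bracket_def F1_def F2_def S_simps trilinearD[OF tri] small)
  have D3: "op_bracket S F2 = (\<lambda>a b c. s 3 (F3 a b c))"
    by (intro ext) (simp add: op_bracket_def F2_def F3_def S_simps trilinearD[OF tri] small)
  have D4: "op_bracket S F3 = (\<lambda>a b c. s 4 (F4 a b c))"
    by (intro ext) (simp add: op_bracket_def F3_def F4_def S_simps trilinearD[OF tri] small)
  have iterates:
    "(op_bracket S ^^ 1) \<Theta> = F1"
    "(op_bracket S ^^ 2) \<Theta> = (\<lambda>a b c. s 2 (F2 a b c))"
    "(op_bracket S ^^ 3) \<Theta> = (\<lambda>a b c. s 6 (F3 a b c))"
    "(op_bracket S ^^ 4) \<Theta> = (\<lambda>a b c. s 24 (F4 a b c))"
    by (simp_all add: numeral_eq_Suc[of "num.Bit0 _"] numeral_eq_Suc[of "num.Bit1 _"]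
        D1 D2 D3 D4 scale)
  have "exp_twist s S \<Theta> a b c =
      (\<Sum>i\<le>4. s (1 / fact i) ((op_bracket S ^^ i) \<Theta> a b c))"
    unfolding exp_twist_def
  proof (rule Sum_any.expand_superset)
    show "{i. s (1 / fact i) ((op_bracket S ^^ i) \<Theta> a b c) \<noteq> 0} \<subseteq> {..4}"
    proof
      fix i assume i: "i \<in> {i. s (1 / fact i) ((op_bracket S ^^ i) \<Theta> a b c) \<noteq> 0}"
      show "i \<in> {..4}"
      proof (rule ccontr)
        assume "i \<notin> {..4}"
        then have "i \<ge> 5" by simp
        then show False using i op_bracket_iterate_eq_0[OF tri lin SS, of i] by simp
      qed
    qed
  qed simp
  also have "\<dots> = s (1 / fact 0) ((op_bracket S ^^ 0) \<Theta> a b c)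
      + s (1 / fact 1) ((op_bracket S ^^ 1) \<Theta> a b c)
      + s (1 / fact 2) ((op_bracket S ^^ 2) \<Theta> a b c)
      + s (1 / fact 3) ((op_bracket S ^^ 3) \<Theta> a b c)
      + s (1 / fact 4) ((op_bracket S ^^ 4) \<Theta> a b c)"
  proof -
    have "{..4::nat} = {0, 1, 2, 3, 4}" by auto
    then show ?thesis by (simp only:) (simp add: add_ac)
  qed
  also have "\<dots> = \<Theta> a b c + F1 a b c + F2 a b c + F3 a b c + F4 a b c"
    unfolding iterates by (simp add: fact_numeral)
  also have "\<dots> = (\<lambda>x. x - S x) (\<Theta> (a + S a) (b + S b) (c + S c))"
    by (simp add: F1_def F2_def F3_def F4_def S_simps trilinearD[OF tri])
  finally show "exp_twist s S \<Theta> a b c =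
    (\<lambda>x. x - S x) (\<Theta> (a + S a) (b + S b) (c + S c))" .
qed

section \<open>Transport of a 3-Lie bracket\<close>

text \<open>In a nested bracket the inner \<open>\<psi>\<close> meets an outer \<open>\<phi>\<close> and cancels, so that each term of the
  fundamental identity is \<open>\<psi>\<close> of the original term at the arguments \<open>\<phi> x\<^sub>i\<close>.\<close>

lemma three_Lie_algebra_transport:
  assumes "three_Lie_algebra s br"
    and \<phi>: "Vector_Spaces.linear s s \<phi>" and \<psi>: "Vector_Spaces.linear s s \<psi>"
    and inv: "\<And>x. \<phi> (\<psi> x) = x"
  shows "three_Lie_algebra s (\<lambda>a b c. \<psi> (br (\<phi> a) (\<phi> b) (\<phi> c)))"
proof -
  interpret three_Lie_algebra s br by fact
  interpret \<phi>: Vector_Spaces.linear s s \<phi> by fact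
  interpret \<psi>: Vector_Spaces.linear s s \<psi> by fact
  show ?thesis
  proof
    show "trilinear s (\<lambda>a b c. \<psi> (br (\<phi> a) (\<phi> b) (\<phi> c)))"
      unfolding trilinear_def Vector_Spaces.linear_iff
      by (simp add: vector_space_axioms \<phi>.add \<psi>.add \<phi>.scale \<psi>.scale trilinearD[OF trilinear])
  next
    fix x y z
    show "\<psi> (br (\<phi> y) (\<phi> x) (\<phi> z)) = - \<psi> (br (\<phi> x) (\<phi> y) (\<phi> z))"
      by (subst skew12) (rule \<psi>.neg)
    show "\<psi> (br (\<phi> x) (\<phi> z) (\<phi> y)) = - \<psi> (br (\<phi> x) (\<phi> y) (\<phi> z))"
      by (subst skew23) (rule \<psi>.neg)
  next
    fix x1 x2 x3 x4 x5
    show "\<psi> (br (\<phi> x1) (\<phi> x2) (\<phi> (\<psi> (br (\<phi> x3) (\<phi> x4) (\<phi> x5))))) =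
      \<psi> (br (\<phi> (\<psi> (br (\<phi> x1) (\<phi> x2) (\<phi> x3)))) (\<phi> x4) (\<phi> x5)) +
      \<psi> (br (\<phi> x3) (\<phi> (\<psi> (br (\<phi> x1) (\<phi> x2) (\<phi> x4)))) (\<phi> x5)) +
      \<psi> (br (\<phi> x3) (\<phi> x4) (\<phi> (\<psi> (br (\<phi> x1) (\<phi> x2) (\<phi> x5)))))"
      unfolding inv \<psi>.add[symmetric] by (simp only: fundamental_identity[of "\<phi> x1" "\<phi> x2"])
  qed
qed

section \<open>The semidirect product\<close>

context three_Lie_representation
begin

sublocale pair: vector_space_prod sg sv ..

lemma fin_dim_space_prod: "fin_dim_space (module_prod.scale sg sv)"
proof -
  obtain B where "finite_dimensional_vector_space sg B" using g.finite_dim by blast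
  then interpret B: finite_dimensional_vector_space sg B .
  obtain C where "finite_dimensional_vector_space sv C" using V.finite_dim by blast
  then interpret C: finite_dimensional_vector_space sv C .
  interpret BC: finite_dimensional_vector_space_prod sg sv B C ..
  show ?thesis
    by unfold_locales (rule exI, rule BC.p.finite_dimensional_vector_space_axioms)
qed

lemma \<rho>_simps:
  "\<rho> (x + x') y v = \<rho> x y v + \<rho> x' y v" "\<rho> x (y + y') v = \<rho> x y v + \<rho> x y' v"
  "\<rho> x y (v + v') = \<rho> x y v + \<rho> x y v'"
  "\<rho> (sg k x) y v = sv k (\<rho> x y v)" "\<rho> x (sg k y) v = sv k (\<rho> x y v)"
  "\<rho> x y (sv k v) = sv k (\<rho> x y v)"
  "\<rho> x y (- v) = - \<rho> x y v"
  "\<rho> 0 y v = 0" "\<rho> x 0 v = 0" "\<rho> x y 0 = 0"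
proof -
  interpret L1: Vector_Spaces.linear sg sv "\<lambda>x. \<rho> x y v" for y v by (rule linear1)
  interpret L2: Vector_Spaces.linear sg sv "\<lambda>y. \<rho> x y v" for x v by (rule linear2)
  interpret L3: Vector_Spaces.linear sv sv "\<rho> x y" for x y by (rule endo)
  show "\<rho> (x + x') y v = \<rho> x y v + \<rho> x' y v" by (rule L1.add)
  show "\<rho> x (y + y') v = \<rho> x y v + \<rho> x y' v" by (rule L2.add)
  show "\<rho> x y (v + v') = \<rho> x y v + \<rho> x y v'" by (rule L3.add)
  show "\<rho> (sg k x) y v = sv k (\<rho> x y v)" by (rule L1.scale)
  show "\<rho> x (sg k y) v = sv k (\<rho> x y v)" by (rule L2.scale)
  show "\<rho> x y (sv k v) = sv k (\<rho> x y v)" by (rule L3.scale)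
  show "\<rho> x y (- v) = - \<rho> x y v" by (rule L3.neg)
  show "\<rho> 0 y v = 0" by (rule L1.zero)
  show "\<rho> x 0 v = 0" by (rule L2.zero)
  show "\<rho> x y 0 = 0" by (rule L3.zero)
qed

lemma semidirect_Pair:
  "semidirect br \<rho> (x, u) (y, v) (z, w) = (br x y z, \<rho> x y w + \<rho> y z u + \<rho> z x v)"
  by (simp add: semidirect_def)

text \<open>In the \<open>V\<close>-component of the fundamental identity, which is linear in the five vectors of
  \<open>V\<close>, the terms in \<open>u3\<close>, \<open>u4\<close>, \<open>u5\<close> cancel by the first axiom of a representation; those in
  \<open>u1\<close> and \<open>u2\<close>, where the inner bracket enters \<open>\<rho>\<close>, cancel by the second.\<close>

lemma semidirect_three_Lie_algebra:
  "three_Lie_algebra (module_prod.scale sg sv) (semidirect br \<rho>)"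
proof -
  interpret P: fin_dim_space "module_prod.scale sg sv" by (rule fin_dim_space_prod)
  show ?thesis
  proof
    show "trilinear (module_prod.scale sg sv) (semidirect br \<rho>)"
      unfolding trilinear_def Vector_Spaces.linear_iff
      by (auto simp: pair.p.vector_space_axioms semidirect_Pair pair.scale_prod \<rho>_simps
          trilinearD[OF g.trilinear] V.scale_right_distrib)
  next
    fix a b c :: "'g \<times> 'v"
    obtain x u y v z w where abc: "a = (x, u)" "b = (y, v)" "c = (z, w)"
      by (cases a; cases b; cases c) blast
    show "semidirect br \<rho> b a c = - semidirect br \<rho> a b c"
      using g.skew12[of y x z] skew[of y x w] skew[of x z v] skew[of z y u]
      by (simp add: abc semidirect_Pair)
    show "semidirect br \<rho> a c b = - semidirect br \<rho> a b c"
      using g.skew23[of x z y] skew[of x z v] skew[of z y u] skew[of y x w]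
      by (simp add: abc semidirect_Pair)
  next
    fix a1 a2 a3 a4 a5 :: "'g \<times> 'v"
    obtain x1 u1 x2 u2 x3 u3 x4 u4 x5 u5 where
      a: "a1 = (x1, u1)" "a2 = (x2, u2)" "a3 = (x3, u3)" "a4 = (x4, u4)" "a5 = (x5, u5)"
      by (cases a1; cases a2; cases a3; cases a4; cases a5) blast
    have u5: "\<rho> x1 x2 (\<rho> x3 x4 u5) =
        \<rho> (br x1 x2 x3) x4 u5 + \<rho> x3 (br x1 x2 x4) u5 + \<rho> x3 x4 (\<rho> x1 x2 u5)"
      by (rule rep1)
    have u3: "\<rho> x1 x2 (\<rho> x4 x5 u3) =
        \<rho> (br x1 x2 x4) x5 u3 + \<rho> x4 (br x1 x2 x5) u3 + \<rho> x4 x5 (\<rho> x1 x2 u3)"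
      by (rule rep1)
    have u4: "\<rho> x1 x2 (\<rho> x5 x3 u4) =
        \<rho> (br x1 x2 x5) x3 u4 + \<rho> x5 (br x1 x2 x3) u4 + \<rho> x5 x3 (\<rho> x1 x2 u4)"
      by (rule rep1)
    have u1: "\<rho> x2 (br x3 x4 x5) u1 =
        \<rho> x4 x5 (\<rho> x2 x3 u1) + \<rho> x5 x3 (\<rho> x2 x4 u1) + \<rho> x3 x4 (\<rho> x2 x5 u1)"
      using rep2[of x2 x3 x4 x5 u1] skew[of x5 x3 "\<rho> x2 x4 u1"] by simp
    have u2: "\<rho> (br x3 x4 x5) x1 u2 =
        \<rho> x4 x5 (\<rho> x3 x1 u2) + \<rho> x5 x3 (\<rho> x4 x1 u2) + \<rho> x3 x4 (\<rho> x5 x1 u2)"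
      using rep2[of x1 x3 x4 x5 u2] skew[of x5 x3 "\<rho> x1 x4 u2"]
        skew[of "br x3 x4 x5" x1 u2] skew[of x3 x1 u2] skew[of x4 x1 u2] skew[of x5 x1 u2]
      by (simp add: \<rho>_simps)
    show "semidirect br \<rho> a1 a2 (semidirect br \<rho> a3 a4 a5) =
        semidirect br \<rho> (semidirect br \<rho> a1 a2 a3) a4 a5 +
        semidirect br \<rho> a3 (semidirect br \<rho> a1 a2 a4) a5 +
        semidirect br \<rho> a3 a4 (semidirect br \<rho> a1 a2 a5)"
      using g.fundamental_identity[of x1 x2 x3 x4 x5]
      by (simp add: a semidirect_Pair \<rho>_simps u1 u2 u3 u4 u5)
  qed
qed

section \<open>The twisted semidirect product\<close>

lemma linear_lift_op:
  assumes "Vector_Spaces.linear sv sg T"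
  shows "Vector_Spaces.linear (module_prod.scale sg sv) (module_prod.scale sg sv) (lift_op T)"
proof -
  interpret T: Vector_Spaces.linear sv sg T by fact
  show ?thesis
    unfolding Vector_Spaces.linear_iff
    by (auto simp: pair.p.vector_space_axioms lift_op_def pair.scale_prod T.add T.scale)
qed

lemma lift_op_lift_op:
  assumes "Vector_Spaces.linear sv sg T"
  shows "lift_op T (lift_op T a) = 0"
proof -
  interpret T: Vector_Spaces.linear sv sg T by fact
  show ?thesis by (simp add: lift_op_def T.zero zero_prod_def)
qed

lemma twisted_semidirect_eq_conjugate:
  assumes "Vector_Spaces.linear sv sg T"
  shows "exp_twist (module_prod.scale sg sv) (lift_op T) (semidirect br \<rho>) =
    (\<lambda>a b c. (\<lambda>x. x - lift_op T x)
      (semidirect br \<rho> (a + lift_op T a) (b + lift_op T b) (c + lift_op T c)))"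
  by (intro exp_twist_eq_conjugate three_Lie_algebra.trilinear semidirect_three_Lie_algebra
      linear_lift_op lift_op_lift_op assms)

lemma twisted_semidirect_three_Lie_algebra:
  assumes T: "Vector_Spaces.linear sv sg T"
  shows "three_Lie_algebra (module_prod.scale sg sv)
    (exp_twist (module_prod.scale sg sv) (lift_op T) (semidirect br \<rho>))"
proof -
  interpret S: Vector_Spaces.linear "module_prod.scale sg sv" "module_prod.scale sg sv" "lift_op T"
    by (rule linear_lift_op[OF T])
  show ?thesis
    unfolding twisted_semidirect_eq_conjugate[OF T]
  proof (rule three_Lie_algebra_transport[OF semidirect_three_Lie_algebra])
    show "Vector_Spaces.linear (module_prod.scale sg sv) (module_prod.scale sg sv)
        (\<lambda>a. a + lift_op T a)"
      unfolding Vector_Spaces.linear_iff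
      by (simp add: pair.p.vector_space_axioms S.add S.scale pair.p.scale_right_distrib)
    show "Vector_Spaces.linear (module_prod.scale sg sv) (module_prod.scale sg sv)
        (\<lambda>a. a - lift_op T a)"
      unfolding Vector_Spaces.linear_iff
      by (simp add: pair.p.vector_space_axioms S.add S.scale pair.p.scale_right_diff_distrib)
    show "(a - lift_op T a) + lift_op T (a - lift_op T a) = a" for a
      by (simp add: S.diff lift_op_lift_op[OF T])
  qed
qed

lemma twisted_semidirect_on_g:
  assumes T: "Vector_Spaces.linear sv sg T"
  shows "exp_twist (module_prod.scale sg sv) (lift_op T) (semidirect br \<rho>) (x, 0) (y, 0) (z, 0) =
    (br x y z, 0)"
proof -
  interpret T: Vector_Spaces.linear sv sg T by fact
  show ?thesis
    by (simp add: twisted_semidirect_eq_conjugate[OF T] lift_op_def T.zero semidirect_Pair \<rho>_simps)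
qed

lemma twisted_semidirect_on_V:
  assumes T: "Vector_Spaces.linear sv sg T"
  shows "exp_twist (module_prod.scale sg sv) (lift_op T) (semidirect br \<rho>) (0, u) (0, v) (0, w) =
    (br (T u) (T v) (T w) - T (\<rho> (T u) (T v) w + \<rho> (T v) (T w) u + \<rho> (T w) (T u) v),
     \<rho> (T u) (T v) w + \<rho> (T v) (T w) u + \<rho> (T w) (T u) v)"
  by (simp add: twisted_semidirect_eq_conjugate[OF T] lift_op_def semidirect_Pair)

end

theorem theorem5p3:
  fixes sg :: "'k::{alg_closed_field,field_char_0} \<Rightarrow> 'g::ab_group_add \<Rightarrow> 'g"
    and br :: "'g \<Rightarrow> 'g \<Rightarrow> 'g \<Rightarrow> 'g"
    and sv :: "'k \<Rightarrow> 'v::ab_group_add \<Rightarrow> 'v"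
    and \<rho> :: "'g \<Rightarrow> 'g \<Rightarrow> 'v \<Rightarrow> 'v"
    and T :: "'v \<Rightarrow> 'g"
  assumes "three_Lie_algebra sg br"
    and "three_Lie_representation sg br sv \<rho>"
    and "Vector_Spaces.linear sv sg T"
  shows "O_operator sg br sv \<rho> T \<longleftrightarrow>
    twilled_three_Lie_algebra (module_prod.scale sg sv)
      (exp_twist (module_prod.scale sg sv) (lift_op T) (semidirect br \<rho>))
      (UNIV \<times> {0}) ({0} \<times> UNIV)"
proof -
  interpret three_Lie_representation sg br sv \<rho> by fact
  let ?s = "module_prod.scale sg sv"
  let ?br = "exp_twist ?s (lift_op T) (semidirect br \<rho>)"
  note T = assms(3)
  have "subalgebra ?s ?br (UNIV \<times> {0})"
    unfolding subalgebra_def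
    by (auto simp: twisted_semidirect_on_g[OF T]
        intro!: pair.subspace_Times g.subspace_UNIV V.subspace_single_0)
  moreover have "subalgebra ?s ?br ({0} \<times> UNIV) \<longleftrightarrow>
      (\<forall>u v w. br (T u) (T v) (T w) =
        T (\<rho> (T u) (T v) w + \<rho> (T v) (T w) u + \<rho> (T w) (T u) v))"
  proof -
    have "module.subspace ?s ({0} \<times> UNIV)"
      by (intro pair.subspace_Times V.subspace_UNIV g.subspace_single_0)
    then show ?thesis
      unfolding subalgebra_def by (auto simp: twisted_semidirect_on_V[OF T])
  qed
  moreover have "UNIV \<times> {0} \<inter> {0} \<times> UNIV = {0 :: 'g \<times> 'v}"
    by (auto simp: zero_prod_def)
  moreover have "{x + y | x y. x \<in> UNIV \<times> {0} \<and> y \<in> {0} \<times> UNIV} = (UNIV :: ('g \<times> 'v) set)"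
  proof (intro equalityI subsetI UNIV_I)
    fix a :: "'g \<times> 'v"
    have "a = (fst a, 0) + (0, snd a)" by (simp add: prod_eq_iff)
    then show "a \<in> {x + y | x y. x \<in> UNIV \<times> {0} \<and> y \<in> {0} \<times> UNIV}" by blast
  qed
  ultimately show ?thesis
    using T twisted_semidirect_three_Lie_algebra[OF T]
    by (simp add: O_operator_def twilled_three_Lie_algebra_def)
qed

end
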